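(* Let $k\ge2$ and $m>n\ge2$ be integers. The following are equivalent: (1) there exist functions $g,f_0,\dots,f_{k-1}:m\to n$ with no $\mathsf{PHP}^m_n$-solution in common (i.e., there is no pair $\{i,j\}$, $i\ne j$, that is a solution to all of $g,f_0,\dots,f_{k-1}$); (2) $\mathsf{ACC}_k\le_{\mathrm W}(\mathsf{PHP}^m_n)'$; (3) $\mathsf{ACC}_k\le^*_{\mathrm W}(\mathsf{PHP}^m_n)'$.
   Context: A number $N\ge1$ is identified with $\{0,\dots,N-1\}$. A problem $\mathsf{P}$ consists of a nonempty set of instances and, for each instance, a nonempty set of solutions; instances and solutions are coded as elements of Baire space $\mathbb N^{\mathbb N}$ in a standard way. $\mathsf{P}\le_{\mathrm W}\mathsf{Q}$ (Weihrauch reducibility) if there are Turing functionals (effectively continuous partial maps on $\mathbb N^{\mathbb N}$) $\Phi,\Psi$ such that for every $\mathsf{P}$-instance $p$, $\Phi(p)$ is a $\mathsf{Q}$-instance and for every $\mathsf{Q}$-solution $q$ of $\Phi(p)$, $\Psi(p,q)$ is a $\mathsf{P}$-solution of $p$; $\le^*_{\mathrm W}$ is the same with $\Phi,\Psi$ merely continuous. For $m>n\ge2$, $\mathsf{PHP}^m_n$ has as instances all functions $f:m\to n$, with solutions all unordered pairs $\{i,j\}$, $i\ne j$, $f(i)=f(j)$; its jump $(\mathsf{PHP}^m_n)'$ has as instances all pointwise convergent sequences $(f_s:m\to n)_{s\in\mathbb N}$, with solutions all $\{i,j\}$, $i\ne j$, $\lim_s f_s(i)=\lim_s f_s(j)$.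 For $k\ge2$, $\mathsf{ACC}_k$ has as instances those $p\in\mathbb N^{\mathbb N}$ such that either there is a unique $\ell<k$ that appears in $p$ (then every $j<k$ with $j\ne\ell$ is a solution), or $p$ is the constant sequence with value $k$ (then every $j<k$ is a solution). *)

theory Defs
  imports "HOL-Analysis.Function_Topology" "HOL-Library.Nat_Bijection" "HOL-Library.FuncSet"
begin

type_synonym baire = "nat \<Rightarrow> nat"

record ('i, 's) problem =
  instances :: "'i set"
  solutions :: "'i \<Rightarrow> 's set"

definition is_problem :: "('i, 's) problem \<Rightarrow> bool" where
  "is_problem P \<longleftrightarrow> instances P \<noteq> {} \<and> (\<forall>x \<in> instances P. solutions P x \<noteq> {})"


subsection \<open>Turing functionals and continuous functionals\<close>

text \<open>
  Kleene's partial recursive functions relative to an oracle \<open>p\<close>: the usual schemes together with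
  the basic function \<open>x \<mapsto> p x\<close>.
\<close>

datatype orec =
    Zero
  | Succ
  | Oracle
  | Proj nat
  | Comp orec "orec list"
  | PrimRec orec orec
  | Mu orec

inductive evaluates :: "baire \<Rightarrow> orec \<Rightarrow> nat list \<Rightarrow> nat \<Rightarrow> bool" for p :: baire where
  Zero: "evaluates p Zero xs 0"
| Succ: "evaluates p Succ [x] (Suc x)"
| Oracle: "evaluates p Oracle [x] (p x)"
| Proj: "i < length xs \<Longrightarrow> evaluates p (Proj i) xs (xs ! i)"
| Comp: "list_all2 (\<lambda>g y. evaluates p g xs y) gs ys \<Longrightarrow> evaluates p f ys z
    \<Longrightarrow> evaluates p (Comp f gs) xs z"
| PrimRec_0: "evaluates p f xs y \<Longrightarrow> evaluates p (PrimRec f g) (0 # xs) y"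
| PrimRec_Suc: "evaluates p (PrimRec f g) (t # xs) y \<Longrightarrow> evaluates p g (t # y # xs) z
    \<Longrightarrow> evaluates p (PrimRec f g) (Suc t # xs) z"
| Mu: "evaluates p f (t # xs) 0 \<Longrightarrow> (\<forall>i<t. \<exists>y>0. evaluates p f (i # xs) y)
    \<Longrightarrow> evaluates p (Mu f) xs t"

inductive_cases evaluates_ZeroE: "evaluates p Zero xs y"
inductive_cases evaluates_SuccE: "evaluates p Succ xs y"
inductive_cases evaluates_OracleE: "evaluates p Oracle xs y"
inductive_cases evaluates_ProjE: "evaluates p (Proj i) xs y"
inductive_cases evaluates_CompE: "evaluates p (Comp f gs) xs y"
inductive_cases evaluates_PrimRec_0E: "evaluates p (PrimRec f g) (0 # xs) y"
inductive_cases evaluates_PrimRec_SucE: "evaluates p (PrimRec f g) (Suc t # xs) y"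
inductive_cases evaluates_MuE: "evaluates p (Mu f) xs y"

lemma evaluates_deterministic:
  "evaluates p e xs y \<Longrightarrow> evaluates p e xs y' \<Longrightarrow> y = y'"
proof (induction arbitrary: y' rule: evaluates.induct)
  case (Zero xs)
  then show ?case by (rule evaluates_ZeroE) simp
next
  case (Succ x)
  then show ?case by (rule evaluates_SuccE) simp
next
  case (Oracle x)
  then show ?case by (rule evaluates_OracleE) simp
next
  case (Proj i xs)
  from Proj.prems show ?case by (rule evaluates_ProjE) simp
next
  case (Comp xs gs ys f z)
  from Comp.prems obtain ys' where
    1: "list_all2 (\<lambda>g y. evaluates p g xs y) gs ys'" and 2: "evaluates p f ys' y'"
    by (rule evaluates_CompE)
  have len: "length gs = length ys" "length gs = length ys'"
    using Comp.IH(1) 1 by (blast dest: list_all2_lengthD)+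
  have "ys = ys'"
  proof (rule nth_equalityI)
    fix i assume "i < length ys"
    then have i: "i < length gs" using len by simp
    show "ys ! i = ys' ! i"
      using list_all2_nthD[OF Comp.IH(1) i] list_all2_nthD[OF 1 i] by blast
  qed (use len in simp)
  with 2 Comp.IH(2) show ?case by blast
next
  case (PrimRec_0 f xs y g)
  from PrimRec_0.prems have "evaluates p f xs y'" by (rule evaluates_PrimRec_0E)
  then show ?case by (rule PrimRec_0.IH)
next
  case (PrimRec_Suc f g t xs y z)
  from PrimRec_Suc.prems obtain w where
    1: "evaluates p (PrimRec f g) (t # xs) w" and 2: "evaluates p g (t # w # xs) y'"
    by (rule evaluates_PrimRec_SucE)
  from PrimRec_Suc.IH(1)[OF 1] 2 have "evaluates p g (t # y # xs) y'" by simp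
  then show ?case by (rule PrimRec_Suc.IH(2))
next
  case (Mu f t xs)
  from Mu.prems have 1: "evaluates p f (y' # xs) 0"
    and 2: "\<forall>i<y'. \<exists>y>0. evaluates p f (i # xs) y"
    by - (erule evaluates_MuE, assumption)+
  have "\<not> t < y'"
  proof
    assume "t < y'"
    with 2 obtain y where "0 < y" "evaluates p f (t # xs) y" by blast
    with Mu.IH(1) show False by blast
  qed
  moreover have "\<not> y' < t"
  proof
    assume "y' < t"
    with Mu.IH(2) obtain y where "0 < y" "\<forall>z. evaluates p f (y' # xs) z \<longrightarrow> y = z" by blast
    with 1 show False by blast
  qed
  ultimately show ?case by simp
qed

definition turing_functional :: "(baire \<rightharpoonup> baire) \<Rightarrow> bool" where
  "turing_functional F \<longleftrightarrow> (\<exists>e. \<forall>p. F p =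
     (if \<forall>x. \<exists>y. evaluates p e [x] y then Some (\<lambda>x. THE y. evaluates p e [x] y) else None))"

text \<open>
  Continuity is with respect to the subspace topology on the (arbitrary) domain, \<open>nat \<Rightarrow> nat\<close>
  carrying the product of the discrete topologies.
\<close>

definition continuous_functional :: "(baire \<rightharpoonup> baire) \<Rightarrow> bool" where
  "continuous_functional F \<longleftrightarrow> continuous_on (dom F) (\<lambda>p. the (F p))"


subsection \<open>Weihrauch reducibility\<close>

definition join :: "baire \<Rightarrow> baire \<Rightarrow> baire" where
  "join p q = (\<lambda>x. if even x then p (x div 2) else q (x div 2))"

definition reducible_by ::
  "((baire \<rightharpoonup> baire) \<Rightarrow> bool) \<Rightarrow> (baire, baire) problem \<Rightarrow> (baire, baire) problem \<Rightarrow> bool" where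
  "reducible_by C P Q \<longleftrightarrow> (\<exists>\<Phi> \<Psi>. C \<Phi> \<and> C \<Psi> \<and>
     (\<forall>p \<in> instances P. \<exists>p'. \<Phi> p = Some p' \<and> p' \<in> instances Q \<and>
        (\<forall>q \<in> solutions Q p'. \<exists>r. \<Psi> (join p q) = Some r \<and> r \<in> solutions P p)))"

definition weihrauch_le :: "(baire, baire) problem \<Rightarrow> (baire, baire) problem \<Rightarrow> bool"
    (infix "\<le>\<^sub>W" 50) where
  "P \<le>\<^sub>W Q \<longleftrightarrow> reducible_by turing_functional P Q"

definition cont_weihrauch_le :: "(baire, baire) problem \<Rightarrow> (baire, baire) problem \<Rightarrow> bool"
    (infix "\<le>\<^sup>*\<^sub>W" 50) where
  "P \<le>\<^sup>*\<^sub>W Q \<longleftrightarrow> reducible_by continuous_functional P Q"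


subsection \<open>Codings\<close>

text \<open>
  \<open>\<delta> p x\<close> reads ``\<open>p\<close> is a code of \<open>x\<close>''; an object may have several codes, but a code
  determines the instance it codes.
\<close>

definition coded ::
  "(baire \<Rightarrow> 'i \<Rightarrow> bool) \<Rightarrow> (baire \<Rightarrow> 's \<Rightarrow> bool) \<Rightarrow> ('i, 's) problem \<Rightarrow> (baire, baire) problem"
where
  "coded \<delta> \<epsilon> P =
     \<lparr>instances = {p. \<exists>x \<in> instances P. \<delta> p x},
      solutions = (\<lambda>p. {q. \<exists>x \<in> instances P. \<delta> p x \<and> (\<exists>y \<in> solutions P x. \<epsilon> q y)})\<rparr>"

definition codes_nat :: "baire \<Rightarrow> nat \<Rightarrow> bool" where
  "codes_nat p j \<longleftrightarrow> p 0 = j"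

definition codes_finset :: "baire \<Rightarrow> nat set \<Rightarrow> bool" where
  "codes_finset p X \<longleftrightarrow> p 0 = set_encode X"

definition codes_funseq :: "nat \<Rightarrow> baire \<Rightarrow> (nat \<Rightarrow> nat \<Rightarrow> nat) \<Rightarrow> bool" where
  "codes_funseq m p F \<longleftrightarrow> (\<forall>s. p s = list_encode (map (F s) [0..<m]))"


subsection \<open>The problems\<close>

definition PHP :: "nat \<Rightarrow> nat \<Rightarrow> (nat \<Rightarrow> nat, nat set) problem" where
  "PHP m n =
     \<lparr>instances = {..<m} \<rightarrow>\<^sub>E {..<n},
      solutions = (\<lambda>f. {{i, j} | i j. i < m \<and> j < m \<and> i \<noteq> j \<and> f i = f j})\<rparr>"

definition PHP_jump :: "nat \<Rightarrow> nat \<Rightarrow> (nat \<Rightarrow> nat \<Rightarrow> nat, nat set) problem" where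
  "PHP_jump m n =
     \<lparr>instances = {F. (\<forall>s. F s \<in> {..<m} \<rightarrow>\<^sub>E {..<n}) \<and> (\<forall>i<m. convergent (\<lambda>s. F s i))},
      solutions = (\<lambda>F. {{i, j} | i j. i < m \<and> j < m \<and> i \<noteq> j \<and>
                                       lim (\<lambda>s. F s i) = lim (\<lambda>s. F s j)})\<rparr>"

definition ACC :: "nat \<Rightarrow> (baire, nat) problem" where
  "ACC k =
     \<lparr>instances = {p. (\<exists>!l. l < k \<and> l \<in> range p) \<or> p = (\<lambda>_. k)},
      solutions = (\<lambda>p. if \<exists>!l. l < k \<and> l \<in> range p
                       then {j. j < k \<and> j \<noteq> (THE l. l < k \<and> l \<in> range p)}
                       else {..<k})\<rparr>"

abbreviation PHP_jump_coded :: "nat \<Rightarrow> nat \<Rightarrow> (baire, baire) problem" where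
  "PHP_jump_coded m n \<equiv> coded (codes_funseq m) codes_finset (PHP_jump m n)"

abbreviation ACC_coded :: "nat \<Rightarrow> (baire, baire) problem" where
  "ACC_coded k \<equiv> coded (=) codes_nat (ACC k)"

lemma codes_funseq_unique:
  assumes "codes_funseq m p F" "codes_funseq m p G"
    and "F \<in> instances (PHP_jump m n)" "G \<in> instances (PHP_jump m n)"
  shows "F = G"
proof
  fix s
  have "map (F s) [0..<m] = map (G s) [0..<m]"
    using assms(1,2) unfolding codes_funseq_def by (metis list_encode_eq)
  then have "\<forall>i<m. F s i = G s i" by auto
  moreover have "F s \<in> {..<m} \<rightarrow>\<^sub>E {..<n}" "G s \<in> {..<m} \<rightarrow>\<^sub>E {..<n}"
    using assms(3,4) by (auto simp: PHP_jump_def)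
  ultimately show "F s = G s" by (meson PiE_ext lessThan_iff)
qed

lemma pigeonhole_pair:
  fixes h :: "nat \<Rightarrow> nat"
  assumes "n < m" "\<And>i. i < m \<Longrightarrow> h i < n"
  shows "\<exists>i j. i < m \<and> j < m \<and> i \<noteq> j \<and> h i = h j"
proof -
  have "\<not> inj_on h {..<m}"
    using assms card_inj_on_le[of h "{..<m}" "{..<n}"] by (auto simp: image_subset_iff)
  then show ?thesis by (auto simp: inj_on_def)
qed

lemma is_problem_PHP:
  assumes "n < m" "2 \<le> n"
  shows "is_problem (PHP m n)"
  unfolding is_problem_def
proof (intro conjI ballI)
  have "(\<lambda>i\<in>{..<m}. 0) \<in> {..<m} \<rightarrow>\<^sub>E {..<n}"
    using assms by (intro restrict_PiE_iff[THEN iffD2]) simp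
  then have "(\<lambda>i\<in>{..<m}. 0) \<in> instances (PHP m n)" by (simp add: PHP_def)
  then show "instances (PHP m n) \<noteq> {}" by blast
next
  fix f assume "f \<in> instances (PHP m n)"
  then have "\<And>i. i < m \<Longrightarrow> f i < n" by (auto simp: PHP_def)
  from pigeonhole_pair[of n m f, OF assms(1) this]
  obtain i j where "i < m" "j < m" "i \<noteq> j" "f i = f j" by blast
  then have "{i, j} \<in> solutions (PHP m n) f"
    unfolding PHP_def problem.simps mem_Collect_eq
    by - (rule exI[of _ i], rule exI[of _ j], simp)
  then show "solutions (PHP m n) f \<noteq> {}" by blast
qed

lemma is_problem_PHP_jump:
  assumes "n < m" "2 \<le> n"
  shows "is_problem (PHP_jump m n)"
  unfolding is_problem_def
proof (intro conjI ballI)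
  have "(\<lambda>i\<in>{..<m}. 0) \<in> {..<m} \<rightarrow>\<^sub>E {..<n}"
    using assms by (intro restrict_PiE_iff[THEN iffD2]) simp
  then have "(\<lambda>_. \<lambda>i\<in>{..<m}. 0) \<in> instances (PHP_jump m n)" by (simp add: PHP_jump_def convergent_const)
  then show "instances (PHP_jump m n) \<noteq> {}" by blast
next
  fix F assume "F \<in> instances (PHP_jump m n)"
  then have fn: "\<And>s. F s \<in> {..<m} \<rightarrow>\<^sub>E {..<n}" and conv: "\<And>i. i < m \<Longrightarrow> convergent (\<lambda>s. F s i)"
    by (simp_all add: PHP_jump_def)
  have "lim (\<lambda>s. F s i) < n" if i: "i < m" for i
  proof -
    have "(\<lambda>s. F s i) \<longlonglongrightarrow> lim (\<lambda>s. F s i)"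
      using conv[OF i] by (simp add: convergent_LIMSEQ_iff)
    then have "\<forall>\<^sub>F s in sequentially. F s i = lim (\<lambda>s. F s i)"
      by (simp add: tendsto_discrete)
    then obtain s where "F s i = lim (\<lambda>s. F s i)"
      by (meson eventually_sequentially le_refl)
    moreover have "F s i < n" using PiE_mem[OF fn, of i s] i by simp
    ultimately show ?thesis by simp
  qed
  from pigeonhole_pair[of n m "\<lambda>i. lim (\<lambda>s. F s i)", OF assms(1) this]
  obtain i j where "i < m" "j < m" "i \<noteq> j" "lim (\<lambda>s. F s i) = lim (\<lambda>s. F s j)" by blast
  then have "{i, j} \<in> solutions (PHP_jump m n) F"
    unfolding PHP_jump_def problem.simps mem_Collect_eq
    by - (rule exI[of _ i], rule exI[of _ j], simp)
  then show "solutions (PHP_jump m n) F \<noteq> {}" by blast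
qed

lemma is_problem_ACC:
  assumes "2 \<le> k"
  shows "is_problem (ACC k)"
proof -
  have "\<exists>j<k. j \<noteq> l" for l :: nat
  proof (cases "l = 0")
    case True
    then show ?thesis using assms by (intro exI[of _ 1]) auto
  next
    case False
    then show ?thesis using assms by (intro exI[of _ 0]) auto
  qed
  then have "solutions (ACC k) p \<noteq> {}" for p
    using assms by (auto simp: ACC_def lessThan_empty_iff)
  moreover have "(\<lambda>_. k) \<in> instances (ACC k)" by (simp add: ACC_def)
  ultimately show ?thesis by (auto simp: is_problem_def)
qed

end

theory Submission
  imports Defs
begin

text \<open>
  From functions \<open>g, f\<^sub>0, \<dots>, f\<^bsub>k-1\<^esub>\<close> without a common solution one gets a reduction: play \<open>g\<close>
  until some \<open>l < k\<close> shows up in the \<open>ACC\<close>-instance, and \<open>f\<^sub>l\<close> from then on.  A pair that is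
  not a solution of some \<open>f\<^sub>l\<close> yields the answer \<open>l\<close>; a pair that solves all \<open>f\<^sub>l\<close> does not solve \<open>g\<close>,
  so some \<open>l < k\<close> must appear in the instance, and one can wait for it.

  Conversely, run a continuous reduction on the constant sequence \<open>k\<close> and let \<open>g\<close> be the limit of
  the resulting instance.  The answers to the finitely many solutions of \<open>g\<close> depend only on a
  prefix of length \<open>N\<close>; let \<open>f\<^sub>l\<close> be the limit for the sequence that is \<open>k\<close> except for an \<open>l\<close> at
  position \<open>N\<close>.  The answer to a common solution would be below \<open>k\<close> and different from every \<open>l < k\<close>.
\<close>

subsection \<open>Turing functionals are continuous\<close>

text \<open>Reading one coordinate is a continuous map into a discrete space, hence locally
  constant. This settles a single oracle query.\<close>

lemma eventually_nhds_baire_eq: "\<forall>\<^sub>F q in nhds p. q x = p x" for p :: baire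
proof -
  have "continuous_on UNIV (\<lambda>q::baire. q x)"
    by simp
  then have "((\<lambda>q::baire. q x) \<longlongrightarrow> p x) (nhds p)"
    using tendsto_at_iff_tendsto_nhds[of "\<lambda>q. q x" p] by (simp add: continuous_on_def)
  then show ?thesis
    by (simp add: tendsto_discrete)
qed

text \<open>A halting computation queries the oracle finitely often, so it survives small changes of
  the oracle. In the induction each rule has only finitely many premises, and their neighbourhoods
  can be intersected.\<close>

lemma evaluates_eventually_nhds:
  "evaluates p e xs y \<Longrightarrow> \<forall>\<^sub>F q in nhds p. evaluates q e xs y"
proof (induction rule: evaluates.induct)
  case (Oracle x)
  from eventually_nhds_baire_eq[of x p] show ?case
    by eventually_elim (metis evaluates.Oracle)
next
  case (Comp xs gs ys f z)
  have len: "length gs = length ys"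
    using Comp.IH(1) by (rule list_all2_lengthD)
  have "\<forall>\<^sub>F q in nhds p. \<forall>i\<in>{..<length gs}. evaluates q (gs ! i) xs (ys ! i)"
    using Comp.IH(1) by (intro eventually_ball_finite) (auto simp: list_all2_conv_all_nth)
  with Comp.IH(2) show ?case
    by eventually_elim (auto intro!: evaluates.Comp simp: list_all2_conv_all_nth len)
next
  case (PrimRec_Suc f g t xs y z)
  from PrimRec_Suc.IH show ?case
    by eventually_elim (rule evaluates.PrimRec_Suc)
next
  case (Mu f t xs)
  \<comment> \<open>Minimization depends on finitely many failed tests before the zero at
    \<open>t\<close>, so one neighbourhood serves all of them.\<close>
  have "\<forall>\<^sub>F q in nhds p. \<forall>i\<in>{..<t}. \<exists>y>0. evaluates q f (i # xs) y"
  proof (intro eventually_ball_finite ballI)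
    fix i assume "i \<in> {..<t}"
    with Mu.IH(2) obtain y where "y > 0" "\<forall>\<^sub>F q in nhds p. evaluates q f (i # xs) y"
      by auto
    then show "\<forall>\<^sub>F q in nhds p. \<exists>y>0. evaluates q f (i # xs) y"
      by (auto elim: eventually_mono)
  qed simp
  with Mu.IH(1) show ?case
    by eventually_elim (auto intro: evaluates.Mu)
qed (auto intro: evaluates.intros always_eventually elim: eventually_mono)

text \<open>Each output value comes from one halting computation and is therefore locally constant
  on the domain; in the product topology continuity can be checked coordinate by coordinate.\<close>

lemma turing_functional_imp_continuous:
  assumes "turing_functional F"
  shows "continuous_functional F"
proof -
  obtain e where e: "\<And>p. F p = (if \<forall>x. \<exists>y. evaluates p e [x] y
      then Some (\<lambda>x. THE y. evaluates p e [x] y) else None)"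
    using assms by (auto simp: turing_functional_def)
  have value_eq: "the (F q) x = y" if "q \<in> dom F" "evaluates q e [x] y" for q x y
  proof -
    have "the (F q) x = (THE y. evaluates q e [x] y)"
      using that(1) e[of q] by (auto split: if_splits)
    with that(2) show ?thesis
      by (metis evaluates_deterministic the_equality)
  qed
  have "continuous_on (dom F) (\<lambda>p. the (F p) x)" for x
    unfolding continuous_on_def
  proof
    fix p assume p: "p \<in> dom F"
    then obtain y where y: "evaluates p e [x] y"
      using e[of p] by (auto split: if_splits)
    have "\<forall>\<^sub>F q in at p within dom F. evaluates q e [x] y"
      using evaluates_eventually_nhds[OF y] by (auto simp: eventually_at_filter elim: eventually_mono)
    moreover have "\<forall>\<^sub>F q in at p within dom F. q \<in> dom F"
      by (simp add: eventually_at_filter)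
    ultimately have "\<forall>\<^sub>F q in at p within dom F. the (F q) x = the (F p) x"
      by eventually_elim (simp add: value_eq[OF p y] value_eq)
    then show "((\<lambda>p. the (F p) x) \<longlongrightarrow> the (F p) x) (at p within dom F)"
      by (rule tendsto_eventually)
  qed
  then show ?thesis
    unfolding continuous_functional_def by (rule continuous_on_coordinatewise_then_product)
qed

lemma weihrauch_le_imp_cont_weihrauch_le: "P \<le>\<^sub>W Q \<Longrightarrow> P \<le>\<^sup>*\<^sub>W Q"
  unfolding weihrauch_le_def cont_weihrauch_le_def reducible_by_def
  using turing_functional_imp_continuous by blast


subsection \<open>Programs\<close>

lemma evaluates_Comp1:
  "evaluates p g xs y \<Longrightarrow> evaluates p f [y] z \<Longrightarrow> evaluates p (Comp f [g]) xs z"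
  by (rule evaluates.Comp[of p xs "[g]" "[y]"]) simp_all

lemma evaluates_Comp2:
  "evaluates p g xs y \<Longrightarrow> evaluates p h xs y' \<Longrightarrow> evaluates p f [y, y'] z
    \<Longrightarrow> evaluates p (Comp f [g, h]) xs z"
  by (rule evaluates.Comp[of p xs "[g, h]" "[y, y']"]) simp_all

lemma evaluates_Proj:
  "i < length xs \<Longrightarrow> xs ! i = y \<Longrightarrow> evaluates p (Proj i) xs y"
  using evaluates.Proj by blast

text \<open>Here \<open>r\<close> is a closed form of the recursion, to be guessed by the user of
  the rule.\<close>

lemma evaluates_PrimRec:
  assumes "evaluates p f xs (r 0)"
    and "\<And>t. evaluates p g (t # r t # xs) (r (Suc t))"
  shows "evaluates p (PrimRec f g) (t # xs) (r t)"
  using assms by (induction t) (simp_all add: evaluates.PrimRec_0 evaluates.PrimRec_Suc)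

lemma ex_program_const: "\<exists>e. \<forall>p xs. evaluates p e xs c"
proof (induction c)
  case 0
  show ?case by (blast intro: evaluates.Zero)
next
  case (Suc c)
  then show ?case by (blast intro: evaluates_Comp1 evaluates.Succ)
qed

text \<open>Finite tables can be hard-wired: split off the value at \<open>0\<close> and treat the
  shifted function by induction. Tables obtained by a non-effective choice are thereby available to
  programs.\<close>

lemma ex_program_eventually_const:
  assumes "\<And>x. N \<le> x \<Longrightarrow> f x = f N"
  shows "\<exists>e. \<forall>p x. evaluates p e [x] (f x)"
  using assms
proof (induction N arbitrary: f)
  case 0
  then show ?case using ex_program_const[of "f 0"] by (metis le0)
next
  case (Suc N)
  have "(f \<circ> Suc) x = (f \<circ> Suc) N" if "N \<le> x" for x
    using Suc.prems[of "Suc x"] that by simp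
  from Suc.IH[of "f \<circ> Suc", OF this] obtain e where e: "\<And>p x. evaluates p e [x] (f (Suc x))"
    by auto
  obtain c where c: "\<And>p xs. evaluates p c xs (f 0)"
    using ex_program_const by blast
  \<comment> \<open>\<open>PrimRec\<close> acts as a case distinction: \<open>Proj 0\<close> passes
    on the predecessor and the recursive value is discarded.\<close>
  have "evaluates p (PrimRec c (Comp e [Proj 0])) [x] (f x)" for p x
    by (rule evaluates_PrimRec) (auto intro!: c e evaluates_Comp1 evaluates_Proj)
  then show ?case by blast
qed

lemma ex_program_double: "\<exists>e. \<forall>p x. evaluates p e [x] (2 * x)"
proof -
  have "evaluates p (PrimRec Zero (Comp Succ [Comp Succ [Proj 1]])) [x] (2 * x)" for p x
  proof (rule evaluates_PrimRec)
    fix t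
    have "evaluates p (Comp Succ [Comp Succ [Proj 1]]) [t, 2 * t] (Suc (Suc (2 * t)))"
      by (rule evaluates_Comp1[OF evaluates_Comp1[OF evaluates_Proj]])
        (auto intro: evaluates.Succ)
    then show "evaluates p (Comp Succ [Comp Succ [Proj 1]]) [t, 2 * t] (2 * Suc t)"
      by simp
  qed (use evaluates.Zero in simp)
  then show ?thesis by blast
qed

lemma ex_program_min: "\<exists>e. \<forall>p x y. evaluates p e [x, y] (min x y)"
proof -
  define pd where "pd = PrimRec Zero (Proj 0)"
  \<comment> \<open>Recursion runs over the first argument, so \<open>sb\<close> sends
    \<open>[x, y]\<close> to the truncated difference \<open>y - x\<close>, with the arguments
    reversed.\<close>
  define sb where "sb = PrimRec (Proj 0) (Comp pd [Proj 1])"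
  have pd: "evaluates p pd [x] (x - 1)" for p x
    unfolding pd_def by (rule evaluates_PrimRec) (auto intro: evaluates.Zero evaluates_Proj)
  have sb: "evaluates p sb [x, y] (y - x)" for p x y
    unfolding sb_def
  proof (rule evaluates_PrimRec)
    show "evaluates p (Comp pd [Proj 1]) [t, y - t, y] (y - Suc t)" for t
      using pd[of p "y - t"] by (intro evaluates_Comp1[of _ _ _ "y - t"] evaluates_Proj) simp_all
  qed (auto intro: evaluates_Proj)
  have "evaluates p (Comp sb [Comp sb [Proj 1, Proj 0], Proj 0]) [x, y] (min x y)" for p x y
  proof -
    have "min x y = x - (x - y)" by simp
    then show ?thesis
      using sb[of p y x] sb[of p "x - y" x]
      by (intro evaluates_Comp2[of _ _ _ "x - y" _ x] evaluates_Comp2[of _ _ _ y _ x]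
          evaluates_Proj) simp_all
  qed
  then show ?thesis by blast
qed

text \<open>Gives a name to the functional computed by a given program, which
  \<open>turing_functional\<close> only quantifies over.\<close>

definition functional_of :: "orec \<Rightarrow> baire \<rightharpoonup> baire" where
  "functional_of e p =
    (if \<forall>x. \<exists>y. evaluates p e [x] y then Some (\<lambda>x. THE y. evaluates p e [x] y) else None)"

lemma turing_functional_functional_of: "turing_functional (functional_of e)"
  by (auto simp: turing_functional_def functional_of_def)

lemma functional_of_eq:
  assumes "\<And>x. evaluates p e [x] (f x)"
  shows "functional_of e p = Some f"
proof -
  have "(THE y. evaluates p e [x] y) = f x" for x
    using assms evaluates_deterministic by blast
  with assms show ?thesis by (auto simp: functional_of_def)
qed

text \<open>The \<open>rec_nat\<close> term is the minimum of \<open>k\<close> and the first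
  \<open>s\<close> oracle entries. It never exceeds \<open>k\<close>, so only finitely many values
  of \<open>c\<close> matter and \<open>c\<close> can be arbitrary.\<close>

lemma ex_program_lookup_min:
  "\<exists>e. \<forall>p s. evaluates p e [s] (c (rec_nat k (\<lambda>t y. min y (p t)) s))"
proof -
  obtain M where M: "\<And>p x y. evaluates p M [x, y] (min x y)"
    using ex_program_min by blast
  obtain K where K: "\<And>p xs. evaluates p K xs k"
    using ex_program_const by blast
  obtain T where T: "\<And>p x. evaluates p T [x] (c (min k x))"
    using ex_program_eventually_const[of k "\<lambda>x. c (min k x)"] by (auto simp: min_def)
  define H where "H = PrimRec K (Comp M [Proj 1, Comp Oracle [Proj 0]])"
  have H: "evaluates p H [s] (rec_nat k (\<lambda>t y. min y (p t)) s)" for p s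
    unfolding H_def
    by (rule evaluates_PrimRec)
      (auto intro!: K M evaluates_Comp2 evaluates_Comp1 evaluates_Proj evaluates.Oracle)
  have "rec_nat k (\<lambda>t y. min y (p t)) s \<le> k" for p and s :: nat
    by (induction s) auto
  then have "evaluates p T [rec_nat k (\<lambda>t y. min y (p t)) s]
      (c (rec_nat k (\<lambda>t y. min y (p t)) s))" for p s
    using T by (metis min.absorb2)
  with H have "evaluates p (Comp T [H]) [s] (c (rec_nat k (\<lambda>t y. min y (p t)) s))" for p s
    by (rule evaluates_Comp1)
  then show ?thesis by blast
qed

text \<open>
  The value \<open>Suc l\<close> of \<open>d\<close> means ``answer \<open>l\<close>'', while \<open>0\<close> means ``wait for a value below \<open>k\<close>
  and answer something else''.
\<close>

lemma ex_program_answer: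
  assumes "\<And>x. N \<le> x \<Longrightarrow> d x = d N" and "2 \<le> k"
  shows "\<exists>e. \<forall>p q. (\<forall>l x. d (q 0) = Suc l \<longrightarrow> evaluates (join p q) e [x] l) \<and>
    (d (q 0) = 0 \<longrightarrow> (\<exists>t. p t < k) \<longrightarrow>
      (\<exists>t j. p t < k \<and> j < k \<and> j \<noteq> p t \<and> (\<forall>x. evaluates (join p q) e [x] j)))"
proof -
  obtain D where D: "\<And>p x. evaluates p D [x] (d x)"
    using ex_program_eventually_const[of N d] assms(1) by blast
  obtain O1 where O1: "\<And>p xs. evaluates p O1 xs 1"
    using ex_program_const by blast
  obtain B where B: "\<And>p x. evaluates p B [x] (2 * x)"
    using ex_program_double by blast
  obtain T where T: "\<And>p x. evaluates p T [x] (if x < k then 0 else 1)"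
    using ex_program_eventually_const[of k "\<lambda>x. if x < k then 0 else 1"] by auto
  obtain U where U: "\<And>p x. evaluates p U [x] (if x = 0 then 1 else 0)"
    using ex_program_eventually_const[of 1 "\<lambda>x. if x = 0 then 1 else 0"] by auto
  \<comment> \<open>In \<open>join p q\<close> the entry \<open>q 0\<close> sits at position
    \<open>1\<close> and \<open>p t\<close> at position \<open>2 * t\<close>.\<close>
  define C where "C = Comp D [Comp Oracle [O1]]"
  define V where "V = Comp Oracle [Comp B [Proj 0]]"
  \<comment> \<open>The test of the search, with zero meaning stop: it succeeds at once if
    \<open>d\<close> supplies an answer, and otherwise as soon as \<open>p t < k\<close>.\<close>
  define W where "W = Comp (PrimRec T Zero) [C, V]"
  \<comment> \<open>For \<open>Suc l\<close> the projection returns the predecessor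
    \<open>l\<close>. For \<open>0\<close> the table \<open>U\<close> turns the value found into a
    different one of \<open>0\<close> and \<open>1\<close>, both below \<open>k\<close>.\<close>
  define A where "A = Comp (Comp (PrimRec U (Proj 0)) [C, V]) [Mu W]"
  have C: "evaluates (join p q) C xs (d (q 0))" for p q xs
  proof -
    have "evaluates (join p q) Oracle [1] (q 0)"
      using evaluates.Oracle[of "join p q" 1] by (simp add: join_def)
    then show ?thesis
      unfolding C_def using O1 D by (blast intro: evaluates_Comp1)
  qed
  have V: "evaluates (join p q) V (t # xs) (p t)" for p q t xs
  proof -
    have "evaluates (join p q) Oracle [2 * t] (p t)"
      using evaluates.Oracle[of "join p q" "2 * t"] by (simp add: join_def)
    moreover have "evaluates (join p q) (Proj 0) (t # xs) t"
      by (simp add: evaluates_Proj)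
    ultimately show ?thesis
      unfolding V_def using B by (blast intro: evaluates_Comp1)
  qed
  have W: "evaluates (join p q) W (t # xs) (if d (q 0) = 0 \<and> \<not> p t < k then 1 else 0)"
    for p q t xs
  proof -
    have "evaluates (join p q) (PrimRec T Zero) [d (q 0), p t]
        (case d (q 0) of 0 \<Rightarrow> if p t < k then 0 else 1 | Suc l \<Rightarrow> 0)"
      by (rule evaluates_PrimRec) (use T[of "join p q" "p t"] in \<open>auto intro: evaluates.Zero\<close>)
    then have "evaluates (join p q) W (t # xs)
        (case d (q 0) of 0 \<Rightarrow> if p t < k then 0 else 1 | Suc l \<Rightarrow> 0)"
      unfolding W_def using C V by (blast intro: evaluates_Comp2)
    then show ?thesis by (cases "d (q 0)") (auto split: if_splits)
  qed
  have A: "evaluates (join p q) A [x]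
      (case d (q 0) of 0 \<Rightarrow> if p t = 0 then 1 else 0 | Suc l \<Rightarrow> l)"
    if "d (q 0) \<noteq> 0 \<or> p t < k" "\<And>i. i < t \<Longrightarrow> d (q 0) = 0 \<and> \<not> p i < k" for p q x t
  proof -
    have "evaluates (join p q) (Mu W) [x] t"
    proof (rule evaluates.Mu)
      show "evaluates (join p q) W [t, x] 0"
        using W[of p q t "[x]"] that(1) by (auto split: if_splits)
      show "\<forall>i<t. \<exists>y>0. evaluates (join p q) W [i, x] y"
      proof (intro allI impI)
        fix i assume "i < t"
        then have "evaluates (join p q) W [i, x] 1"
          using W[of p q i "[x]"] that(2)[of i] by (auto split: if_splits)
        then show "\<exists>y>0. evaluates (join p q) W [i, x] y" by (blast intro: zero_less_one)
      qed
    qed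
    moreover have "evaluates (join p q) (PrimRec U (Proj 0)) [d (q 0), p t]
        (case d (q 0) of 0 \<Rightarrow> if p t = 0 then 1 else 0 | Suc l \<Rightarrow> l)"
      by (rule evaluates_PrimRec) (use U[of "join p q" "p t"] in \<open>auto intro: evaluates_Proj\<close>)
    ultimately show ?thesis
      unfolding A_def using C V by (blast intro: evaluates_Comp1 evaluates_Comp2)
  qed
  show ?thesis
  proof (intro exI[of _ A] allI conjI impI)
    fix p q :: baire and x l assume "d (q 0) = Suc l"
    then show "evaluates (join p q) A [x] l"
      using A[of q p 0 x] by simp
  next
    fix p q :: baire assume d: "d (q 0) = 0" and ex: "\<exists>t. p t < k"
    define t where "t = (LEAST t. p t < k)"
    have t: "p t < k" "\<And>i. i < t \<Longrightarrow> \<not> p i < k"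
      unfolding t_def using ex by (auto intro: LeastI_ex dest: not_less_Least)
    then have "evaluates (join p q) A [x] (if p t = 0 then 1 else 0)" for x
      using A[of q p t x] d by simp
    moreover have "(if p t = 0 then 1 else 0) < k" "(if p t = 0 then 1 else 0) \<noteq> p t"
      using assms(2) by auto
    ultimately show "\<exists>t j. p t < k \<and> j < k \<and> j \<noteq> p t \<and> (\<forall>x. evaluates (join p q) A [x] j)"
      using t(1) by blast
  qed
qed


subsection \<open>The coded problems\<close>

lemma PHP_jump_eventually_const:
  assumes "\<And>s. F s \<in> instances (PHP m n)" and "\<forall>\<^sub>F s in sequentially. F s = G"
  shows "F \<in> instances (PHP_jump m n)"
    and "solutions (PHP_jump m n) F = solutions (PHP m n) G"
proof -
  have "(\<lambda>s. F s i) \<longlonglongrightarrow> G i" for i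
    using assms(2) by (intro tendsto_eventually) (auto elim: eventually_mono)
  then have "convergent (\<lambda>s. F s i)" "lim (\<lambda>s. F s i) = G i" for i
    by (auto simp: convergent_def limI)
  with assms(1) show "F \<in> instances (PHP_jump m n)"
    and "solutions (PHP_jump m n) F = solutions (PHP m n) G"
    by (auto simp: PHP_def PHP_jump_def)
qed

text \<open>Convergent sequences of naturals stabilise, and the \<open>m\<close> coordinates do so
  simultaneously from some stage on. Outside \<open>{..<m}\<close> all functions are
  \<open>undefined\<close>, so the limit is attained as a function.\<close>

lemma PHP_jump_limit:
  assumes "F \<in> instances (PHP_jump m n)"
  obtains G where "G \<in> instances (PHP m n)"
    and "solutions (PHP_jump m n) F = solutions (PHP m n) G"
proof -
  have F: "\<And>s. F s \<in> {..<m} \<rightarrow>\<^sub>E {..<n}" and conv: "\<And>i. i < m \<Longrightarrow> convergent (\<lambda>s. F s i)"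
    using assms by (simp_all add: PHP_jump_def)
  define G where "G = (\<lambda>i\<in>{..<m}. lim (\<lambda>s. F s i))"
  have "\<forall>\<^sub>F s in sequentially. \<forall>i\<in>{..<m}. F s i = G i"
    using conv by (intro eventually_ball_finite)
      (auto simp: G_def convergent_LIMSEQ_iff tendsto_discrete)
  then have ev: "\<forall>\<^sub>F s in sequentially. F s = G"
  proof eventually_elim
    case (elim s)
    then show ?case
      using F[of s] by (auto simp: G_def PiE_def extensional_def fun_eq_iff)
  qed
  then obtain s where "F s = G"
    by (meson eventually_sequentially le_refl)
  then have "G \<in> instances (PHP m n)"
    using F[of s] by (simp add: PHP_def)
  moreover have "solutions (PHP_jump m n) F = solutions (PHP m n) G"
    using F ev by (intro PHP_jump_eventually_const) (simp_all add: PHP_def)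
  ultimately show ?thesis by (rule that)
qed

text \<open>A code determines its instance, so the existential over coded instances collapses to
  \<open>F\<close>.\<close>

lemma solutions_PHP_jump_coded:
  assumes "codes_funseq m p F" and "F \<in> instances (PHP_jump m n)"
  shows "solutions (PHP_jump_coded m n) p = {q. \<exists>X \<in> solutions (PHP_jump m n) F. q 0 = set_encode X}"
proof -
  have "G = F" if "codes_funseq m p G" "G \<in> instances (PHP_jump m n)" for G
    using codes_funseq_unique[OF that(1) assms(1) that(2) assms(2)] .
  with assms show ?thesis
    unfolding coded_def codes_finset_def problem.simps by blast
qed

lemma solutions_PHP_subset: "solutions (PHP m n) f \<subseteq> Pow {..<m}"
  by (auto simp: PHP_def)

lemma finite_solutions_PHP: "finite (solutions (PHP m n) f)"
  by (rule finite_subset[OF solutions_PHP_subset]) simp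

section \<open>Solutions of ACC and the running minimum of an instance\<close>

lemma instances_ACC_coded: "instances (ACC_coded k) = instances (ACC k)"
  by (auto simp: coded_def)

lemma solutions_ACC_coded:
  "p \<in> instances (ACC k) \<Longrightarrow> solutions (ACC_coded k) p = {r. r 0 \<in> solutions (ACC k) p}"
  by (auto simp: coded_def codes_nat_def)

lemma solutions_ACC_present:
  assumes "p \<in> instances (ACC k)" and "p t < k"
  shows "solutions (ACC k) p = {j. j < k \<and> j \<noteq> p t}"
proof -
  have ex1: "\<exists>!l. l < k \<and> l \<in> range p"
    using assms by (auto simp: ACC_def)
  then have "(THE l. l < k \<and> l \<in> range p) = p t"
    using assms(2) by (intro the1_equality) auto
  with ex1 show ?thesis by (simp add: ACC_def)
qed

lemma solutions_ACC_absent: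
  assumes "\<And>t. \<not> p t < k"
  shows "solutions (ACC k) p = {..<k}"
  using assms by (auto simp: ACC_def)

lemma running_min_ACC_absent:
  assumes "\<And>t. \<not> p t < (k::nat)"
  shows "rec_nat k (\<lambda>t y. min y (p t)) s = k"
  using assms by (induction s) (auto simp: min_def not_less)

text \<open>All entries other than the value \<open>p t\<close> are at least \<open>k\<close>, so
  the minimum starts at \<open>k\<close>, never falls below \<open>p t\<close>, and reaches it once
  position \<open>t\<close> has been read.\<close>

lemma running_min_ACC_present:
  assumes p: "p \<in> instances (ACC k)" and t: "p t < k"
  shows "\<forall>\<^sub>F s in sequentially. rec_nat k (\<lambda>t y. min y (p t)) s = p t"
proof -
  have *: "p s = p t \<or> k \<le> p s" for s
    using p t by (auto simp: ACC_def not_less[symmetric])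
  have ge: "p t \<le> rec_nat k (\<lambda>t y. min y (p t)) s" for s
  proof (induction s)
    case (Suc s)
    have "p t \<le> p s" using *[of s] t by linarith
    with Suc show ?case by simp
  qed (use t in simp)
  \<comment> \<open>Stage \<open>s\<close> has read only the positions below \<open>s\<close>, hence
    the bound \<open>Suc t\<close>.\<close>
  have "rec_nat k (\<lambda>t y. min y (p t)) s \<le> p t" if "Suc t \<le> s" for s
    using that by (induction s rule: dec_induct) auto
  with ge show ?thesis
    unfolding eventually_sequentially by (blast intro: antisym)
qed


subsection \<open>The two reductions\<close>

lemma weihrauch_le_if_no_common_solution:
  assumes k: "2 \<le> k"
    and g: "g \<in> instances (PHP m n)" and f: "\<And>l. l < k \<Longrightarrow> f l \<in> instances (PHP m n)"
    and disj: "\<And>X. X \<in> solutions (PHP m n) g \<Longrightarrow> \<exists>l<k. X \<notin> solutions (PHP m n) (f l)"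
  shows "ACC_coded k \<le>\<^sub>W PHP_jump_coded m n"
proof -
  \<comment> \<open>With \<open>g\<close> in slot \<open>k\<close>, the running minimum is itself
    the index of the function to play.\<close>
  define f' where "f' = f(k := g)"
  have f': "f' l \<in> instances (PHP m n)" if "l \<le> k" for l
    using that f g by (auto simp: f'_def)
  define h where "h p = rec_nat k (\<lambda>t y. min y (p t))" for p :: baire
  have h: "h p s \<le> k" for p s
    unfolding h_def by (induction s) auto
  define \<phi> where "\<phi> p s = list_encode (map (f' (h p s)) [0..<m])" for p s
  obtain e1 where e1: "\<And>p s. evaluates p e1 [s] (\<phi> p s)"
    using ex_program_lookup_min[where c = "\<lambda>l. list_encode (map (f' l) [0..<m])" and k = k]
    unfolding \<phi>_def h_def by blast

  define fails where "fails X l \<longleftrightarrow> l < k \<and> X \<notin> solutions (PHP m n) (f l)" for X l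
  \<comment> \<open>\<open>N\<close> exceeds the code of every subset of \<open>{..<m}\<close>;
    cutting the table \<open>d\<close> off there makes it eventually constant.\<close>
  define N where "N = Suc (Max (set_encode ` Pow {..<m}))"
  have N: "set_encode X < N" if "X \<subseteq> {..<m}" for X
    unfolding N_def using that by (simp add: less_Suc_eq_le)
  \<comment> \<open>Given the code of a pair, \<open>d\<close> announces some \<open>l\<close> whose
    \<open>f l\<close> the pair fails to solve. The choice by \<open>SOME\<close> is harmless in a
    finite table.\<close>
  define d where "d c = (if c < N \<and> (\<exists>l. fails (set_decode c) l)
      then Suc (SOME l. fails (set_decode c) l) else 0)" for c
  have "d c = d N" if "N \<le> c" for c
    using that by (simp add: d_def)
  from ex_program_answer[of N d, OF this k] obtain e2 where
    answer: "\<And>p q x l. d (q 0) = Suc l \<Longrightarrow> evaluates (join p q) e2 [x] l" and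
    wait: "\<And>p q. d (q 0) = 0 \<Longrightarrow> \<exists>t. p t < k \<Longrightarrow>
      \<exists>t j. p t < k \<and> j < k \<and> j \<noteq> p t \<and> (\<forall>x. evaluates (join p q) e2 [x] j)"
    by blast

  have "\<exists>p'. functional_of e1 p = Some p' \<and> p' \<in> instances (PHP_jump_coded m n) \<and>
      (\<forall>q \<in> solutions (PHP_jump_coded m n) p'.
        \<exists>r. functional_of e2 (join p q) = Some r \<and> r \<in> solutions (ACC_coded k) p)"
    if "p \<in> instances (ACC_coded k)" for p
  proof -
    have p: "p \<in> instances (ACC k)"
      using that by (simp add: instances_ACC_coded)
    have \<phi>: "functional_of e1 p = Some (\<phi> p)"
      using e1 by (rule functional_of_eq)
    \<comment> \<open>\<open>L\<close> is the limit of the running minimum, so \<open>f' L\<close>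
      is the limit of the instance played.\<close>
    define L where "L = (if \<exists>t. p t < k then p (SOME t. p t < k) else k)"
    have L: "L < k \<and> (\<exists>t. p t = L) \<or> L = k \<and> (\<forall>t. \<not> p t < k)"
      unfolding L_def by (auto intro: someI)
    then have "\<forall>\<^sub>F s in sequentially. h p s = L"
      using running_min_ACC_present[OF p] running_min_ACC_absent[of p k]
      by (auto simp: h_def)
    then have "\<forall>\<^sub>F s in sequentially. f' (h p s) = f' L"
      by (rule eventually_mono) simp
    from PHP_jump_eventually_const[OF f'[OF h] this]
    have inst: "(\<lambda>s. f' (h p s)) \<in> instances (PHP_jump m n)"
      and sol: "solutions (PHP_jump m n) (\<lambda>s. f' (h p s)) = solutions (PHP m n) (f' L)" .
    have codes: "codes_funseq m (\<phi> p) (\<lambda>s. f' (h p s))"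
      by (simp add: codes_funseq_def \<phi>_def)
    with inst have \<phi>_inst: "\<phi> p \<in> instances (PHP_jump_coded m n)"
      by (auto simp: coded_def)
    have "\<exists>r. functional_of e2 (join p q) = Some r \<and> r \<in> solutions (ACC_coded k) p"
      if "q \<in> solutions (PHP_jump_coded m n) (\<phi> p)" for q
    proof -
      from that obtain X where X: "X \<in> solutions (PHP m n) (f' L)" and q: "q 0 = set_encode X"
        by (auto simp: solutions_PHP_jump_coded[OF codes inst] sol)
      have sub: "X \<subseteq> {..<m}" using X solutions_PHP_subset by blast
      then have dec: "set_decode (q 0) = X" "q 0 < N"
        using N by (simp_all add: q finite_subset)
      have "\<exists>j \<in> solutions (ACC k) p. \<forall>x. evaluates (join p q) e2 [x] j"
      proof (cases "\<exists>l. fails X l")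
        case True
        define l where "l = (SOME l. fails X l)"
        have l: "fails X l" using True unfolding l_def by (rule someI_ex)
        have "d (q 0) = Suc l" using True by (simp add: d_def dec l_def)
        \<comment> \<open>If \<open>L < k\<close>, then \<open>X\<close> solves \<open>f L\<close>
          but not \<open>f l\<close>, so \<open>l\<close> is not the forbidden value
          \<open>L\<close>. If \<open>L = k\<close>, no value below \<open>k\<close> is
          forbidden.\<close>
        moreover have "l \<in> solutions (ACC k) p"
        proof (cases "L = k")
          case True
          with L have "\<And>t. \<not> p t < k" by auto
          then show ?thesis using l by (simp add: solutions_ACC_absent fails_def)
        next
          case False
          with L obtain t where t: "p t = L" "L < k" by auto
          with X l have "l \<noteq> L" by (auto simp: fails_def f'_def)
          with t l show ?thesis by (simp add: solutions_ACC_present[OF p, of t] fails_def)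
        qed
        ultimately show ?thesis using answer by blast
      next
        case False
        then have d: "d (q 0) = 0" by (simp add: d_def dec)
        have "X \<notin> solutions (PHP m n) g"
          using False disj by (auto simp: fails_def)
        \<comment> \<open>\<open>L = k\<close> would make \<open>X\<close> a solution of
          \<open>g\<close>; hence a value below \<open>k\<close> appears and the search
          ends.\<close>
        with X L have ex: "\<exists>t. p t < k" by (auto simp: f'_def)
        from wait[of q p, OF d ex] obtain t j where
          j: "p t < k" "j < k" "j \<noteq> p t" "\<And>x. evaluates (join p q) e2 [x] j" by blast
        then show ?thesis using solutions_ACC_present[OF p j(1)] by blast
      qed
      then obtain j where "j \<in> solutions (ACC k) p" "\<And>x. evaluates (join p q) e2 [x] j"
        by blast
      then have "functional_of e2 (join p q) = Some (\<lambda>_. j)" "(\<lambda>_. j) \<in> solutions (ACC_coded k) p"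
        using p by (simp_all add: functional_of_eq solutions_ACC_coded)
      then show ?thesis by blast
    qed
    with \<phi> \<phi>_inst show ?thesis by blast
  qed
  then show ?thesis
    unfolding weihrauch_le_def reducible_by_def
    using turing_functional_functional_of by blast
qed

section \<open>From a continuous reduction to functions without a common solution\<close>

lemma no_common_solution_if_cont_weihrauch_le:
  assumes "ACC_coded k \<le>\<^sup>*\<^sub>W PHP_jump_coded m n"
  obtains g f where "g \<in> instances (PHP m n)" and "\<And>l. l < k \<Longrightarrow> f l \<in> instances (PHP m n)"
    and "\<And>X. X \<in> solutions (PHP m n) g \<Longrightarrow> \<exists>l<k. X \<notin> solutions (PHP m n) (f l)"
proof -
  obtain \<Phi> \<Psi> where cont: "continuous_functional \<Psi>" and
    red: "\<And>p. p \<in> instances (ACC_coded k) \<Longrightarrow> \<exists>p'. \<Phi> p = Some p' \<and>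
      p' \<in> instances (PHP_jump_coded m n) \<and> (\<forall>q \<in> solutions (PHP_jump_coded m n) p'.
        \<exists>r. \<Psi> (join p q) = Some r \<and> r \<in> solutions (ACC_coded k) p)"
    using assms unfolding cont_weihrauch_le_def reducible_by_def by blast
  define code :: "nat set \<Rightarrow> baire" where "code X = (\<lambda>_. set_encode X)" for X
  \<comment> \<open>This strips the codings: the jump instance is replaced by its limit
    \<open>G\<close>, and every solution by one fixed code, which leaves finitely many inputs to
    compare.\<close>
  have red': "\<exists>G \<in> instances (PHP m n). \<forall>X \<in> solutions (PHP m n) G.
      \<exists>r. \<Psi> (join p (code X)) = Some r \<and> r 0 \<in> solutions (ACC k) p"
    if p: "p \<in> instances (ACC k)" for p
  proof -
    obtain p' where p': "p' \<in> instances (PHP_jump_coded m n)"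
      and \<Psi>: "\<And>q. q \<in> solutions (PHP_jump_coded m n) p' \<Longrightarrow>
        \<exists>r. \<Psi> (join p q) = Some r \<and> r \<in> solutions (ACC_coded k) p"
      using red[of p] p by (auto simp: instances_ACC_coded)
    obtain F where F: "codes_funseq m p' F" "F \<in> instances (PHP_jump m n)"
      using p' by (auto simp: coded_def)
    obtain G where G: "G \<in> instances (PHP m n)"
      "solutions (PHP_jump m n) F = solutions (PHP m n) G"
      using PHP_jump_limit[OF F(2)] .
    have "\<exists>r. \<Psi> (join p (code X)) = Some r \<and> r 0 \<in> solutions (ACC k) p"
      if "X \<in> solutions (PHP m n) G" for X
    proof -
      have "code X \<in> solutions (PHP_jump_coded m n) p'"
        using that by (auto simp: solutions_PHP_jump_coded[OF F] G code_def)
      from \<Psi>[OF this] show ?thesis by (auto simp: solutions_ACC_coded[OF p])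
    qed
    with G(1) show ?thesis by blast
  qed

  define c :: baire where "c = (\<lambda>_. k)"
  define spike where "spike l N = c(N := l)" for l N
  have c: "c \<in> instances (ACC k)" by (simp add: ACC_def c_def)
  have spike: "spike l N \<in> instances (ACC k)"
    and sol_spike: "solutions (ACC k) (spike l N) = {j. j < k \<and> j \<noteq> l}" if "l < k" for l N
  proof -
    have "\<exists>!l'. l' < k \<and> l' \<in> range (spike l N)"
      using that by (intro ex1I[of _ l]) (auto simp: spike_def c_def image_iff split: if_splits)
    then show sp: "spike l N \<in> instances (ACC k)" by (simp add: ACC_def)
    show "solutions (ACC k) (spike l N) = {j. j < k \<and> j \<noteq> l}"
      using solutions_ACC_present[OF sp, of N] that by (simp add: spike_def)
  qed
  obtain g where g: "g \<in> instances (PHP m n)" and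
    ans_g: "\<And>X. X \<in> solutions (PHP m n) g \<Longrightarrow>
      \<exists>r. \<Psi> (join c (code X)) = Some r \<and> r 0 \<in> solutions (ACC k) c"
    using red'[OF c] by blast

  \<comment> \<open>The spikes converge to \<open>c\<close>, and the first entry of the answer is
    locally constant on the domain. The domain condition stays as a premise, since \<open>q\<close>
    may code no solution for the spike.\<close>
  have "\<forall>\<^sub>F N in sequentially. join (spike l N) q \<in> dom \<Psi> \<longrightarrow>
      the (\<Psi> (join (spike l N) q)) 0 = the (\<Psi> (join c q)) 0"
    if "join c q \<in> dom \<Psi>" for l q
  proof -
    have "continuous_on (dom \<Psi>) (\<lambda>p. the (\<Psi> p) 0)"
      using cont unfolding continuous_functional_def
      by (rule continuous_on_product_then_coordinatewise)
    then have "((\<lambda>p. the (\<Psi> p) 0) \<longlongrightarrow> the (\<Psi> (join c q)) 0) (at (join c q) within dom \<Psi>)"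
      using that by (auto simp: continuous_on_def)
    then have "\<forall>\<^sub>F p in nhds (join c q). p \<in> dom \<Psi> \<longrightarrow> the (\<Psi> p) 0 = the (\<Psi> (join c q)) 0"
      by (auto simp: tendsto_discrete eventually_at_filter elim: eventually_mono)
    moreover have "filterlim (\<lambda>N. join (spike l N) q) (nhds (join c q)) sequentially"
    proof -
      \<comment> \<open>The spike sits at position \<open>2 * N\<close> of the join, so coordinate
        \<open>x\<close> is unaffected once \<open>N > x div 2\<close>.\<close>
      have "\<forall>\<^sub>F N in sequentially. join (spike l N) q x = join c q x" for x
        using eventually_gt_at_top[of "x div 2"]
        by eventually_elim (simp add: join_def spike_def)
      then have "(\<lambda>N. join (spike l N) q x) \<longlonglongrightarrow> join c q x" for x
        by (rule tendsto_eventually)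
      then have "limitin (product_topology (\<lambda>_. euclidean) UNIV)
          (\<lambda>N. join (spike l N) q) (join c q) sequentially"
        by (simp add: limitin_componentwise)
      then show ?thesis
        by (simp add: euclidean_product_topology)
    qed
    ultimately show ?thesis
      by (auto dest: eventually_compose_filterlim)
  qed
  \<comment> \<open>There are finitely many pairs \<open>X\<close> and values \<open>l\<close>, so a
    single \<open>N\<close> works for all of them.\<close>
  then have ev: "\<forall>\<^sub>F N in sequentially. \<forall>X \<in> solutions (PHP m n) g. \<forall>l \<in> {..<k}.
      join (spike l N) (code X) \<in> dom \<Psi> \<longrightarrow>
      the (\<Psi> (join (spike l N) (code X))) 0 = the (\<Psi> (join c (code X))) 0"
    using ans_g by (intro eventually_ball_finite finite_solutions_PHP ballI finite_lessThan) blast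
  obtain N where N: "\<And>X l. X \<in> solutions (PHP m n) g \<Longrightarrow> l < k \<Longrightarrow>
      join (spike l N) (code X) \<in> dom \<Psi> \<Longrightarrow>
      the (\<Psi> (join (spike l N) (code X))) 0 = the (\<Psi> (join c (code X))) 0"
    using eventually_happens'[OF sequentially_bot ev] by blast

  have "\<forall>l. \<exists>G. l < k \<longrightarrow> G \<in> instances (PHP m n) \<and> (\<forall>X \<in> solutions (PHP m n) G.
      \<exists>r. \<Psi> (join (spike l N) (code X)) = Some r \<and> r 0 \<in> solutions (ACC k) (spike l N))"
    using red'[OF spike] by blast
  then have "\<exists>f. \<forall>l. l < k \<longrightarrow> f l \<in> instances (PHP m n) \<and> (\<forall>X \<in> solutions (PHP m n) (f l).
      \<exists>r. \<Psi> (join (spike l N) (code X)) = Some r \<and> r 0 \<in> solutions (ACC k) (spike l N))"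
    by (rule choice)
  then obtain f where f: "\<And>l. l < k \<Longrightarrow> f l \<in> instances (PHP m n)" and
    ans_f: "\<And>l X. l < k \<Longrightarrow> X \<in> solutions (PHP m n) (f l) \<Longrightarrow>
      \<exists>r. \<Psi> (join (spike l N) (code X)) = Some r \<and> r 0 \<in> solutions (ACC k) (spike l N)"
    by blast
  show ?thesis
  proof (rule that[OF g f])
    fix X assume X: "X \<in> solutions (PHP m n) g"
    \<comment> \<open>The answer on \<open>c\<close> is the index sought: if \<open>X\<close> solved
      \<open>f j\<close>, the answer on \<open>spike j N\<close> would again be \<open>j\<close>,
      which is forbidden there.\<close>
    define j where "j = the (\<Psi> (join c (code X))) 0"
    have j: "j < k"
      using ans_g[OF X] by (auto simp: j_def solutions_ACC_absent c_def)
    have "X \<notin> solutions (PHP m n) (f j)"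
    proof
      assume "X \<in> solutions (PHP m n) (f j)"
      from ans_f[OF j this] obtain r where
        r: "\<Psi> (join (spike j N) (code X)) = Some r" "r 0 \<noteq> j"
        by (auto simp: sol_spike[OF j])
      with N[OF X j] show False by (auto simp: j_def)
    qed
    with j show "\<exists>l<k. X \<notin> solutions (PHP m n) (f l)" by blast
  qed
qed

theorem theorem3p12:
  fixes k m n :: nat
  assumes "2 \<le> k" and "n < m" and "2 \<le> n"
  shows
    "((\<exists>g f. g \<in> instances (PHP m n) \<and> (\<forall>l<k. f l \<in> instances (PHP m n)) \<and>
         \<not> (\<exists>X. X \<in> solutions (PHP m n) g \<and> (\<forall>l<k. X \<in> solutions (PHP m n) (f l))))
        \<longleftrightarrow> ACC_coded k \<le>\<^sub>W PHP_jump_coded m n)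
     \<and> (ACC_coded k \<le>\<^sub>W PHP_jump_coded m n \<longleftrightarrow> ACC_coded k \<le>\<^sup>*\<^sub>W PHP_jump_coded m n)"
  (is "(?one \<longleftrightarrow> ?two) \<and> (?two \<longleftrightarrow> ?three)")
proof -
  have "?one \<Longrightarrow> ?two"
    using weihrauch_le_if_no_common_solution[OF assms(1), of _ m n] by blast
  moreover have "?two \<Longrightarrow> ?three"
    by (rule weihrauch_le_imp_cont_weihrauch_le)
  moreover have "?three \<Longrightarrow> ?one"
    by (erule no_common_solution_if_cont_weihrauch_le) blast
  ultimately show ?thesis by blast
qed

end
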